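(* Let $k\ge 1$ be an integer. The error constant $C$ of the explicit first-order $k$-step Adams-type method with coefficients $\beta_j=(2j+1)/k^2$, $j=0,1,\ldots,k-1$, is equal to $$C=\frac{k}{3}+\frac{1}{6k}.$$
   Context: An explicit $k$-step Adams-type method with real coefficients $\beta_0,\ldots,\beta_{k-1}$ for the ODE system $y'=f(t,y)$ on a uniform grid with step $\tau>0$ is $$y_{m+k}=y_{m+k-1}+\tau(\beta_0 f_m+\ldots+\beta_{k-1}f_{m+k-1}),\qquad f_j=f(t_0+j\tau,y_j).$$ Its generating polynomials are $\rho(\zeta)=\sum_{j=0}^k\alpha_j\zeta^j=\zeta^k-\zeta^{k-1}$ (so $\alpha_k=1$, $\alpha_{k-1}=-1$, all other $\alpha_j=0$) and $\sigma(\zeta)=\sum_{j=0}^{k-1}\beta_j\zeta^j$; set $\beta_k=0$. The error constant of a method of order $p$ is $$C=\frac{C_{p+1}}{\sigma(1)},\qquad C_{p+1}=\frac{1}{(p+1)!}\sum_{j=0}^k\bigl(\alpha_j j^{p+1}-(p+1)\beta_j j^p\bigr).$$ For the method in the claim, $p=1$. *)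

theory Defs
  imports "HOL-Analysis.Analysis" "HOL-Computational_Algebra.Polynomial"
    "HOL-Library.Landau_Symbols"
begin

text \<open>
  An explicit \<open>k\<close>-step Adams-type method
  \<open>y\<^sub>m\<^sub>+\<^sub>k = y\<^sub>m\<^sub>+\<^sub>k\<^sub>-\<^sub>1 + \<tau> (\<beta>\<^sub>0 f\<^sub>m + \<dots> + \<beta>\<^sub>k\<^sub>-\<^sub>1 f\<^sub>m\<^sub>+\<^sub>k\<^sub>-\<^sub>1)\<close> with \<open>k \<ge> 1\<close> is
  represented by \<open>k\<close> and \<open>\<beta> :: nat \<Rightarrow> real\<close>, of which only the values \<open>\<beta> j\<close> with \<open>j < k\<close> are used.
\<close>

definition adams_rho :: "nat \<Rightarrow> real poly" where
  "adams_rho k = monom 1 k - monom 1 (k - 1)"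

definition adams_sigma :: "nat \<Rightarrow> (nat \<Rightarrow> real) \<Rightarrow> real poly" where
  "adams_sigma k \<beta> = (\<Sum>j<k. monom (\<beta> j) j)"

definition smooth :: "(real \<Rightarrow> real) \<Rightarrow> bool" where
  "smooth u \<longleftrightarrow> (\<forall>n x. (deriv ^^ n) u field_differentiable (at x))"

text \<open>
  The residual of the recurrence on the exact solution \<open>u\<close> of an equation \<open>y' = f(t, y)\<close>,
  where \<open>f(t, u(t)) = u'(t)\<close>. Since every smooth \<open>u\<close> solves such an equation, \<open>f\<close> need not be
  mentioned; for systems the residual is taken componentwise.
\<close>

definition adams_residual :: "nat \<Rightarrow> (nat \<Rightarrow> real) \<Rightarrow> (real \<Rightarrow> real) \<Rightarrow> real \<Rightarrow> real \<Rightarrow> real" where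
  "adams_residual k \<beta> u t \<tau> =
     u (t + real k * \<tau>) -
     (u (t + (real k - 1) * \<tau>) + \<tau> * (\<Sum>j<k. \<beta> j * deriv u (t + real j * \<tau>)))"

definition adams_order_at_least :: "nat \<Rightarrow> (nat \<Rightarrow> real) \<Rightarrow> nat \<Rightarrow> bool" where
  "adams_order_at_least k \<beta> p \<longleftrightarrow>
     (\<forall>u t. smooth u \<longrightarrow> adams_residual k \<beta> u t \<in> O[at_right 0](\<lambda>\<tau>. \<tau> ^ (p + 1)))"

definition adams_has_order :: "nat \<Rightarrow> (nat \<Rightarrow> real) \<Rightarrow> nat \<Rightarrow> bool" where
  "adams_has_order k \<beta> p \<longleftrightarrow> adams_order_at_least k \<beta> p \<and> \<not> adams_order_at_least k \<beta> (p + 1)"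

text \<open>
  The constant \<open>C\<^sub>p\<^sub>+\<^sub>1\<close>, indexed by \<open>p\<close>. The coefficient of \<^term>\<open>adams_sigma k \<beta>\<close> at \<open>k\<close> is \<open>0\<close>,
  in accordance with the convention \<open>\<beta>\<^sub>k = 0\<close>.
\<close>

definition adams_C_Suc :: "nat \<Rightarrow> (nat \<Rightarrow> real) \<Rightarrow> nat \<Rightarrow> real" where
  "adams_C_Suc k \<beta> p =
     1 / fact (p + 1) *
     (\<Sum>j=0..k. coeff (adams_rho k) j * real j ^ (p + 1) -
                real (p + 1) * coeff (adams_sigma k \<beta>) j * real j ^ p)"

text \<open>Meaningful when \<open>p\<close> is the order of the method.\<close>

definition adams_error_constant :: "nat \<Rightarrow> (nat \<Rightarrow> real) \<Rightarrow> nat \<Rightarrow> real" where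
  "adams_error_constant k \<beta> p = adams_C_Suc k \<beta> p / poly (adams_sigma k \<beta>) 1"

end

theory Submission
  imports Defs
begin

text \<open>
  With \<open>\<sigma>(1) = 1\<close>, first-order Taylor expansion at \<open>t\<close> cancels all terms of the residual below
  \<open>\<tau>\<^sup>2\<close>, while for \<open>u(t) = t\<^sup>2\<close> the residual at \<open>0\<close> is exactly \<open>2 C\<^sub>2 \<tau>\<^sup>2\<close> with \<open>C\<^sub>2 > 0\<close>.
\<close>

text \<open>The difference quotient converges, so it stays bounded near 0. The filter is
  \<open>nhds 0\<close> and not \<open>at 0\<close> so that steps \<open>a * \<tau>\<close> with
  \<open>a = 0\<close> can be substituted later.\<close>

lemma bigo_increment_nhds:
  fixes g :: "real \<Rightarrow> real"
  assumes "g field_differentiable (at t)"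
  shows "(\<lambda>h. g (t + h) - g t) \<in> O[nhds 0](\<lambda>h. h)"
proof -
  obtain D where "(\<lambda>h. (g (t + h) - g t) / h) \<midarrow>0\<rightarrow> D"
    using assms unfolding field_differentiable_def DERIV_def by blast
  then have "(\<lambda>h. g (t + h) - g t) \<in> O[at 0](\<lambda>h. h)"
    by (rule bigoI_tendsto) (auto simp: eventually_at_filter)
  then obtain c where c: "c > 0" "\<forall>\<^sub>F h in at 0. norm (g (t + h) - g t) \<le> c * norm h"
    by (rule landau_o.bigE)
  from c(2) have "\<forall>\<^sub>F h in nhds 0. norm (g (t + h) - g t) \<le> c * norm h"
    \<comment> \<open>The point \<open>h = 0\<close> may be added because both sides vanish
      there.\<close>
    by (simp add: eventually_nhds_conv_at)
  with c(1) show ?thesis by (rule landau_o.bigI)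
qed

text \<open>By the mean value theorem the remainder is
  \<open>h * (deriv u (t + z) - deriv u t)\<close> for some \<open>z\<close> with |z| \<le> |h|, and
  the second factor is O(h) by the increment bound for \<open>deriv u\<close>. Continuity of the
  second derivative does not enter.\<close>

lemma bigo_taylor_remainder_nhds:
  fixes u :: "real \<Rightarrow> real"
  assumes u: "\<And>x. u field_differentiable (at x)"
    and u': "deriv u field_differentiable (at t)"
  shows "(\<lambda>h. u (t + h) - u t - h * deriv u t) \<in> O[nhds 0](\<lambda>h. h\<^sup>2)"
proof -
  obtain c where c: "c > 0" "\<forall>\<^sub>F h in nhds 0. norm (deriv u (t + h) - deriv u t) \<le> c * norm h"
    using landau_o.bigE[OF bigo_increment_nhds[OF u']] by blast
  then obtain d where d: "d > 0"
    "\<And>h. \<bar>h\<bar> < d \<Longrightarrow> \<bar>deriv u (t + h) - deriv u t\<bar> \<le> c * \<bar>h\<bar>"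
    by (auto simp: eventually_nhds_metric dist_real_def)
  have der: "(u has_real_derivative deriv u x) (at x)" for x
    using u by (simp add: field_differentiable_derivI)
  have "\<bar>u (t + h) - u t - h * deriv u t\<bar> \<le> c * h\<^sup>2" if h: "\<bar>h\<bar> < d" for h
  proof (cases "h = 0")
    case False
    obtain z where z: "\<bar>z\<bar> \<le> \<bar>h\<bar>" "u (t + h) - u t = h * deriv u (t + z)"
    proof (cases "h > 0")
      case True
      then obtain x where "t < x" "x < t + h" "u (t + h) - u t = (t + h - t) * deriv u x"
        using MVT2[of t "t + h" u "deriv u"] der by auto
      then show ?thesis using that[of "x - t"] by auto
    next
      case neg: False
      then obtain x where "t + h < x" "x < t" "u t - u (t + h) = (t - (t + h)) * deriv u x"
        using MVT2[of "t + h" t u "deriv u"] der False by auto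
      then show ?thesis using that[of "x - t"] by (auto simp: algebra_simps)
    qed
    have "\<bar>u (t + h) - u t - h * deriv u t\<bar> = \<bar>h\<bar> * \<bar>deriv u (t + z) - deriv u t\<bar>"
      by (simp add: z(2) flip: abs_mult right_diff_distrib)
    also have "\<dots> \<le> \<bar>h\<bar> * (c * \<bar>z\<bar>)"
      using d(2)[of z] z(1) h by (intro mult_left_mono) auto
    also have "\<dots> \<le> \<bar>h\<bar> * (c * \<bar>h\<bar>)"
      using z(1) c(1) by (intro mult_left_mono) auto
    also have "\<dots> = c * h\<^sup>2"
      by (simp add: power2_eq_square)
    finally show ?thesis .
  qed simp
  then have "\<forall>\<^sub>F h in nhds 0. norm (u (t + h) - u t - h * deriv u t) \<le> c * norm (h\<^sup>2)"
    using d(1) by (auto simp: eventually_nhds_metric dist_real_def)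
  with c(1) show ?thesis by (rule landau_o.bigI)
qed

lemma adams_order_at_least_1:
  assumes "(\<Sum>j<k. \<beta> j) = 1"
  shows "adams_order_at_least k \<beta> 1"
  unfolding adams_order_at_least_def
proof (intro allI impI)
  fix u t assume "smooth u"
  \<comment> \<open>These are the instances \<open>n = 0\<close> and \<open>n = 1\<close> of
    \<open>smooth\<close>.\<close>
  then have u: "u field_differentiable (at x)" "deriv u field_differentiable (at x)" for x
    unfolding smooth_def by (metis funpow_0, metis funpow_0 funpow.simps(2) comp_apply)
  define R where "R h = u (t + h) - u t - h * deriv u t" for h
  define S where "S h = deriv u (t + h) - deriv u t" for h
  \<comment> \<open>The factor \<open>a\<close> is zero for the node \<open>j = 0\<close>, and for
    \<open>k - 1\<close> when \<open>k = 1\<close>, so the limit is taken in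
    \<open>nhds 0\<close>.\<close>
  have lim: "filterlim (\<lambda>\<tau>. a * \<tau>) (nhds 0) (at_right 0)" for a :: real
    by (auto intro!: tendsto_eq_intros)
  have scale: "(\<lambda>\<tau>. (a * \<tau>) ^ n) \<in> O[at_right 0](\<lambda>\<tau>. \<tau> ^ n)" for a :: real and n
    by (simp add: power_mult_distrib)
  have R: "(\<lambda>\<tau>. R (a * \<tau>)) \<in> O[at_right 0](\<lambda>\<tau>. \<tau>\<^sup>2)" for a
    unfolding R_def
    using landau_o.big.compose[OF bigo_taylor_remainder_nhds[OF u(1) u(2)] lim] scale
    by (rule landau_o.big_trans)
  have S: "(\<lambda>\<tau>. S (a * \<tau>)) \<in> O[at_right 0](\<lambda>\<tau>. \<tau>)" for a
    unfolding S_def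
    using landau_o.big.compose[OF bigo_increment_nhds[OF u(2)] lim]
    by (rule landau_o.big_trans) simp
  \<comment> \<open>The values \<open>u t\<close> cancel, and \<open>\<tau> * deriv u t\<close> has
    coefficient k - (k - 1) - \<Sum> \<beta>_j, which is 0 by the assumption. Only remainders are
    left.\<close>
  have eq: "adams_residual k \<beta> u t =
      (\<lambda>\<tau>. R (real k * \<tau>) - R ((real k - 1) * \<tau>) - \<tau> * (\<Sum>j<k. \<beta> j * S (real j * \<tau>)))"
  proof
    fix \<tau>
    have "(\<Sum>j<k. \<beta> j * S (real j * \<tau>)) =
        (\<Sum>j<k. \<beta> j * deriv u (t + real j * \<tau>)) - deriv u t"
      using assms
      by (simp add: S_def right_diff_distrib sum_subtractf flip: sum_distrib_right)
    then show "adams_residual k \<beta> u t \<tau> =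
        R (real k * \<tau>) - R ((real k - 1) * \<tau>) - \<tau> * (\<Sum>j<k. \<beta> j * S (real j * \<tau>))"
      unfolding adams_residual_def R_def by (simp only:) (simp add: algebra_simps)
  qed
  have "(\<lambda>\<tau>. \<Sum>j<k. \<beta> j * S (real j * \<tau>)) \<in> O[at_right 0](\<lambda>\<tau>. \<tau>)"
    by (intro big_sum_in_bigo landau_o.big.cmult_in_iff' [THEN iffD2] S) (auto intro: S)
  then have "(\<lambda>\<tau>. \<tau> * (\<Sum>j<k. \<beta> j * S (real j * \<tau>))) \<in> O[at_right 0](\<lambda>\<tau>. \<tau>\<^sup>2)"
    by (auto simp: power2_eq_square intro: landau_o.big_mult)
  then show "adams_residual k \<beta> u t \<in> O[at_right 0](\<lambda>\<tau>. \<tau> ^ (1 + 1))"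
    unfolding eq using R by (simp add: sum_in_bigo numeral_2_eq_2)
qed

lemma deriv_square: "deriv (\<lambda>x::real. x\<^sup>2) = (\<lambda>x. 2 * x)"
  by (rule ext, rule DERIV_imp_deriv) (auto intro!: derivative_eq_intros)

lemma smooth_square: "smooth (\<lambda>x. x\<^sup>2)"
proof -
  have d2: "deriv (\<lambda>x::real. 2 * x) = (\<lambda>x. 2)"
    by (rule ext, rule DERIV_imp_deriv) (auto intro!: derivative_eq_intros)
  have d3: "(deriv ^^ n) (\<lambda>x::real. c) = (\<lambda>x. if n = 0 then c else 0)" for n c
    by (induction n) auto
  have "(deriv ^^ n) (\<lambda>x::real. x\<^sup>2) field_differentiable (at x)" for n x
  proof -
    \<comment> \<open>From the second derivative on, all derivatives are constants: 2, then
      0.\<close>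
    consider "n = 0" | "n = 1" | m where "n = m + 2"
      by (metis One_nat_def add_2_eq_Suc' not0_implies_Suc)
    then show ?thesis
    proof cases
      case 3
      then have "(deriv ^^ n) (\<lambda>x::real. x\<^sup>2) = (\<lambda>x. if m = 0 then 2 else 0)"
        by (simp add: funpow_Suc_right deriv_square d2 d3 del: funpow.simps(2))
      then show ?thesis by simp
    qed (auto simp: deriv_square intro!: derivative_intros)
  qed
  then show ?thesis by (simp add: smooth_def)
qed

text \<open>Only the coefficients of \<open>adams_rho k\<close> at \<open>k\<close> and
  \<open>k - 1\<close> survive, and that of \<open>adams_sigma k \<beta>\<close> at \<open>k\<close>
  is 0. The assumption \<open>k \<ge> 1\<close> lets the natural number \<open>k - 1\<close> become
  \<open>real k - 1\<close>.\<close>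

lemma adams_C_Suc_eq:
  assumes "k \<ge> 1"
  shows "adams_C_Suc k \<beta> p =
    (real k ^ (p + 1) - (real k - 1) ^ (p + 1) - real (p + 1) * (\<Sum>j<k. \<beta> j * real j ^ p))
      / fact (p + 1)"
proof -
  have \<sigma>: "coeff (adams_sigma k \<beta>) j = (if j < k then \<beta> j else 0)" for j
    by (simp add: adams_sigma_def coeff_sum)
  have "(\<Sum>j=0..k. coeff (adams_rho k) j * real j ^ (p + 1)) =
      (\<Sum>j=0..k. if j = k then real j ^ (p + 1) else 0) -
      (\<Sum>j=0..k. if j = k - 1 then real j ^ (p + 1) else 0)"
    by (subst sum_subtractf [symmetric], rule sum.cong)
       (auto simp: adams_rho_def left_diff_distrib)
  also have "\<dots> = real k ^ (p + 1) - (real k - 1) ^ (p + 1)"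
    using assms by (simp add: of_nat_diff)
  finally have \<rho>: "(\<Sum>j=0..k. coeff (adams_rho k) j * real j ^ (p + 1)) =
      real k ^ (p + 1) - (real k - 1) ^ (p + 1)" .
  have "(\<Sum>j=0..k. real (p + 1) * coeff (adams_sigma k \<beta>) j * real j ^ p) =
      (\<Sum>j<k. real (p + 1) * (\<beta> j * real j ^ p))"
    by (rule sum.mono_neutral_cong_right) (auto simp: \<sigma>)
  then show ?thesis
    unfolding adams_C_Suc_def sum_subtractf \<rho> by (simp add: sum_distrib_left)
qed

text \<open>This ties the error constant to the order: on a quadratic the expansion has no
  remainder, and the factor 2 undoes the division by \<open>fact 2\<close>.\<close>

lemma adams_residual_square:
  assumes "k \<ge> 1"
  shows "adams_residual k \<beta> (\<lambda>x. x\<^sup>2) 0 \<tau> = 2 * adams_C_Suc k \<beta> 1 * \<tau>\<^sup>2"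
proof -
  have "(\<Sum>j<k. \<beta> j * (2 * (real j * \<tau>))) = 2 * \<tau> * (\<Sum>j<k. \<beta> j * real j)"
    unfolding sum_distrib_left by (intro sum.cong) auto
  then show ?thesis
    unfolding adams_C_Suc_eq[OF assms]
    by (simp add: adams_residual_def deriv_square algebra_simps power2_eq_square)
qed

lemma not_adams_order_at_least_2:
  assumes "k \<ge> 1" and "adams_C_Suc k \<beta> 1 \<noteq> 0"
  shows "\<not> adams_order_at_least k \<beta> 2"
proof
  assume "adams_order_at_least k \<beta> 2"
  moreover have "adams_residual k \<beta> (\<lambda>x. x\<^sup>2) 0 = (\<lambda>\<tau>. 2 * adams_C_Suc k \<beta> 1 * \<tau>\<^sup>2)"
    using assms(1) by (intro ext adams_residual_square)
  ultimately have "(\<lambda>\<tau>. 2 * adams_C_Suc k \<beta> 1 * \<tau>\<^sup>2) \<in> O[at_right 0](\<lambda>\<tau>. \<tau> ^ 3)"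
    using smooth_square unfolding adams_order_at_least_def
    by (metis one_add_one add.commute numeral_3_eq_3 numeral_2_eq_2 Suc_eq_plus1)
  then have "(\<lambda>\<tau>::real. \<tau>\<^sup>2) \<in> O[at_right 0](\<lambda>\<tau>. \<tau> ^ 3)"
    using assms(2) by simp
  \<comment> \<open>Combined with the previous bound, this makes \<open>\<tau>\<^sup>2\<close>
    little-o of itself, hence eventually 0, although \<open>at_right 0\<close> only sees \<tau> >
    0.\<close>
  moreover have "(\<lambda>\<tau>::real. \<tau> ^ 3) \<in> o[at_right 0](\<lambda>\<tau>. \<tau>\<^sup>2)"
  proof (rule smalloI_tendsto)
    have "(\<lambda>\<tau>::real. \<tau> ^ 3 / \<tau>\<^sup>2) = (\<lambda>\<tau>. \<tau>)"
      by (rule ext) (simp add: power2_eq_square power3_eq_cube)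
    then show "((\<lambda>\<tau>::real. \<tau> ^ 3 / \<tau>\<^sup>2) \<longlongrightarrow> 0) (at_right 0)"
      by simp
  qed (auto simp: eventually_at_filter)
  ultimately have "(\<lambda>\<tau>::real. \<tau>\<^sup>2) \<in> o[at_right 0](\<lambda>\<tau>. \<tau>\<^sup>2)"
    by (rule landau_o.big_small_trans)
  then have "\<forall>\<^sub>F \<tau>::real in at_right 0. \<tau>\<^sup>2 = 0"
    by (simp add: landau_o.small_refl_iff)
  then have "\<forall>\<^sub>F \<tau>::real in at_right 0. False"
    by (auto simp: eventually_at_filter)
  then show False by simp
qed

theorem proposition1:
  fixes k :: nat and \<beta> :: "nat \<Rightarrow> real"
  assumes "k \<ge> 1"
    and "\<And>j. j < k \<Longrightarrow> \<beta> j = (2 * real j + 1) / (real k)\<^sup>2"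
  shows "adams_has_order k \<beta> 1 \<and>
         adams_error_constant k \<beta> 1 = real k / 3 + 1 / (6 * real k)"
proof -
  have k: "real k > 0" using assms(1) by simp
  \<comment> \<open>The first n odd numbers add up to the square of n, so the denominator of \<beta>
    normalises \<sigma>(1) to 1.\<close>
  have sum1: "(\<Sum>j<n. 2 * real j + 1) = (real n)\<^sup>2" for n
    by (induction n) (auto simp: power2_eq_square algebra_simps)
  \<comment> \<open>The closed form is twice the sum of squares plus the sum of the integers below
    n.\<close>
  have sum2: "(\<Sum>j<n. (2 * real j + 1) * real j) = real n * (real n - 1) * (4 * real n + 1) / 6" for n
    by (induction n) (auto simp: field_simps)
  have \<sigma>: "(\<Sum>j<k. \<beta> j) = 1"
    using k by (simp add: assms(2) sum1 flip: sum_divide_distrib)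
  have "(\<Sum>j<k. \<beta> j * real j) = (\<Sum>j<k. (2 * real j + 1) * real j) / (real k)\<^sup>2"
    unfolding sum_divide_distrib by (intro sum.cong) (auto simp: assms(2))
  also have "\<dots> = (real k - 1) * (4 * real k + 1) / (6 * real k)"
    unfolding sum2 by (simp add: power2_eq_square)
  finally have "(\<Sum>j<k. \<beta> j * real j) = (real k - 1) * (4 * real k + 1) / (6 * real k)" .
  \<comment> \<open>Here C_2 = k - 1/2 - (k - 1)(4k + 1)/(6k) = (2k^2 + 1)/(6k).\<close>
  then have C: "adams_C_Suc k \<beta> 1 = real k / 3 + 1 / (6 * real k)"
    unfolding adams_C_Suc_eq[OF assms(1)] using k
    by (simp add: field_simps power2_eq_square)
  \<comment> \<open>Positivity excludes order 2, so the order is exactly 1.\<close>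
  have "adams_C_Suc k \<beta> 1 > 0"
    unfolding C using k by (simp add: add_pos_pos)
  then have "adams_has_order k \<beta> 1"
    unfolding adams_has_order_def
    using adams_order_at_least_1[OF \<sigma>] not_adams_order_at_least_2[OF assms(1)]
    by (metis less_irrefl one_add_one)
  \<comment> \<open>Dividing by \<sigma>(1) = 1 leaves C_2 itself as the error constant.\<close>
  moreover have "poly (adams_sigma k \<beta>) 1 = 1"
    by (simp add: adams_sigma_def poly_sum poly_monom \<sigma>)
  ultimately show ?thesis
    unfolding adams_error_constant_def C by simp
qed

end
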